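(* Let $\Theta$ be a non-empty finite parameter space, let $\mathcal I$ be the set of all (coded, finite, effective) inference bases with parameter space $\Theta$, let $L,S,C\subseteq\mathcal I\times\mathcal I$ be the likelihood, sufficiency and conditionality relations, and let $\mathcal A$ be any set. For a relation $D\subseteq\mathcal I\times\mathcal I$ let $\mathcal G_D^{(\mathcal A)}$ be the class of statistical procedures $Ev\subseteq\mathcal I\times\mathcal A$ that preserve $D$. Then: (a) $\mathcal G_L^{(\mathcal A)}=\mathcal G_C^{(\mathcal A)}$; (b) $\mathcal G_L^{(\mathcal A)}\subseteq\mathcal G_S^{(\mathcal A)}$, and the inclusion is strict if and only if $|\Theta|\ge 2$ and $\mathcal A\neq\varnothing$; (c) $\mathcal G_L^{(\mathcal A)}=\mathcal G_C^{(\mathcal A)}\cap\mathcal G_S^{(\mathcal A)}$.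
   Context: **Models and inference bases.** Fix a non-empty finite set $\Theta$ and work in a fixed set-theoretic universe. A statistical model $E$ consists of a finite non-empty sample space $\mathcal X_E$, a family of probability mass functions $f_{E,\theta}$ on $\mathcal X_E$ ($\theta\in\Theta$), and an injective outcome code $c_E:\mathcal X_E\to\mathbb N$, such that every outcome is effective: for each $x\in\mathcal X_E$ there is $\theta\in\Theta$ with $f_{E,\theta}(x)>0$. Write $\mathbb P_{E,\theta}$ for the probability with mass function $f_{E,\theta}$. An inference base is a pair $I=(E,x)$ with $x\in\mathcal X_E$; $\mathcal I$ is the set of all inference bases with parameter space $\Theta$. Below $I_i=(E_i,x_i)$. **Likelihood relation.** $(I_1,I_2)\in L$ iff there is $k>0$ with $f_{E_1,\theta}(x_1)=k f_{E_2,\theta}(x_2)$ for all $\theta\in\Theta$. **Sufficiency relation.** For a surjection $T:\mathcal X_E\to\mathcal X_{E_T}$ (a statistic), the induced model $E_T$ has mass functions $f_{E_T,\theta}(t)=\sum_{x:T(x)=t}f_{E,\theta}(x)$. $T$ is sufficient if the conditional distribution given $T$ is free of $\theta$, i.e. there is a function $g$ on $\mathcal X_E$ with $f_{E,\theta}(x)=g(x)f_{E_T,\theta}(T(x))$ for all $x,\theta$; it is minimal sufficient if it is sufficient and is a function of every sufficient statistic. $(I_1,I_2)\in S$ iff there are minimal sufficient statistics $T_i:\mathcal X_{E_i}\to\mathcal X_{E_{T_i}}$ (surjective), $i=1,2$, and a bijection $h:\mathcal X_{E_{T_2}}\to\mathcal X_{E_{T_1}}$ with $f_{E_{T_1},\theta}(h(t))=f_{E_{T_2},\theta}(t)$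 for all $\theta\in\Theta$, $t\in\mathcal X_{E_{T_2}}$, and $T_1(x_1)=h(T_2(x_2))$. **Conditionality relation.** A statistic $A:\mathcal X_E\to\mathcal A_0$ is ancillary for $E$ if its distribution under $\mathbb P_{E,\theta}$ does not depend on $\theta$. Say $I_1\to I_2$ if there are an ancillary statistic $A:\mathcal X_{E_1}\to\mathcal A_0$ for $E_1$ with, for $a=A(x_1)$, $\mathbb P_{E_1,\theta}(A=a)>0$ for every $\theta$, and an injection $\iota:\mathcal X_{E_2}\to\mathcal X_{E_1}$ with image exactly $A^{-1}\{a\}$, $\iota(x_2)=x_1$, and $f_{E_2,\theta}(y)=f_{E_1,\theta}(\iota(y))/\mathbb P_{E_1,\theta}(A=a)$ for all $\theta\in\Theta$, $y\in\mathcal X_{E_2}$, such that at least one of the following holds: (ordinary branch) $c_{E_1}(\iota(y))=c_{E_2}(y)$ for every $y\in\mathcal X_{E_2}$; (mixed-experiment branch) $A$ is surjective onto $\mathcal A_0$ and $\mathcal A_0$ has at least two elements (no condition on codes). Then $(I_1,I_2)\in C$ iff $I_1\to I_2$ or $I_2\to I_1$. **Procedures.** A statistical procedure with codomain $\mathcal A$ is any relation $Ev\subseteq\mathcal I\times\mathcal A$; its output set at $I$ is $Ev(I)=\{a\in\mathcal A:(I,a)\in Ev\}$, which may be empty. $Ev$ preserves $D\subseteq\mathcal I\times\mathcal I$ if $(I_1,I_2)\in D$ implies $Ev(I_1)=Ev(I_2)$. *)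

theory Defs
  imports "HOL-Probability.Probability_Mass_Function"
begin

text \<open>
  The parameter space is the type \<open>'p\<close> (of class \<open>finite\<close> in the theorem, hence non-empty and
  finite).  The fixed set-theoretic universe is the type \<open>'x\<close> (infinite in the theorem): sample
  spaces are finite subsets of \<open>'x\<close> and statistics take values in \<open>'x\<close>.
\<close>

record ('p, 'x) model =
  outcomes :: "'x set"
  distr :: "'p \<Rightarrow> 'x pmf"
  code :: "'x \<Rightarrow> nat"

abbreviation mass :: "('p, 'x) model \<Rightarrow> 'p \<Rightarrow> 'x \<Rightarrow> real" where
  "mass E \<theta> \<equiv> pmf (distr E \<theta>)"

abbreviation Prob :: "('p, 'x) model \<Rightarrow> 'p \<Rightarrow> 'x set \<Rightarrow> real" where
  "Prob E \<theta> \<equiv> measure_pmf.prob (distr E \<theta>)"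

text \<open>
  The code is a function on the sample space only, so its values elsewhere are fixed by
  \<open>extensional\<close>; two models are then equal iff they have the same sample space, mass functions and
  outcome codes.
\<close>

definition is_model :: "('p, 'x) model \<Rightarrow> bool" where
  "is_model E \<longleftrightarrow>
     finite (outcomes E) \<and> outcomes E \<noteq> {} \<and>
     (\<forall>\<theta>. set_pmf (distr E \<theta>) \<subseteq> outcomes E) \<and>
     code E \<in> extensional (outcomes E) \<and> inj_on (code E) (outcomes E) \<and>
     (\<forall>x\<in>outcomes E. \<exists>\<theta>. mass E \<theta> x > 0)"

type_synonym ('p, 'x) base = "('p, 'x) model \<times> 'x"

definition inference_bases :: "('p, 'x) base set" where
  "inference_bases = {(E, x). is_model E \<and> x \<in> outcomes E}"

definition likelihood_rel :: "('p, 'x) base rel" where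
  "likelihood_rel =
     {((E1, x1), (E2, x2)).
        (E1, x1) \<in> inference_bases \<and> (E2, x2) \<in> inference_bases \<and>
        (\<exists>k>0. \<forall>\<theta>. mass E1 \<theta> x1 = k * mass E2 \<theta> x2)}"

text \<open>
  A statistic of \<open>E\<close> is the restriction of a function \<open>T\<close> to \<open>outcomes E\<close>.  Being surjective, its
  codomain, the sample space of the induced model, is \<open>T ` outcomes E\<close>.
\<close>

definition induced_mass :: "('p, 'x) model \<Rightarrow> ('x \<Rightarrow> 'x) \<Rightarrow> 'p \<Rightarrow> 'x \<Rightarrow> real" where
  "induced_mass E T \<theta> t = (\<Sum>x | x \<in> outcomes E \<and> T x = t. mass E \<theta> x)"

definition sufficient :: "('p, 'x) model \<Rightarrow> ('x \<Rightarrow> 'x) \<Rightarrow> bool" where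
  "sufficient E T \<longleftrightarrow>
     (\<exists>g. \<forall>\<theta>. \<forall>x\<in>outcomes E. mass E \<theta> x = g x * induced_mass E T \<theta> (T x))"

definition minimal_sufficient :: "('p, 'x) model \<Rightarrow> ('x \<Rightarrow> 'x) \<Rightarrow> bool" where
  "minimal_sufficient E T \<longleftrightarrow>
     sufficient E T \<and>
     (\<forall>U. sufficient E U \<longrightarrow> (\<exists>\<phi>. \<forall>x\<in>outcomes E. T x = \<phi> (U x)))"

definition sufficiency_rel :: "('p, 'x) base rel" where
  "sufficiency_rel =
     {((E1, x1), (E2, x2)).
        (E1, x1) \<in> inference_bases \<and> (E2, x2) \<in> inference_bases \<and>
        (\<exists>T1 T2 h.
           minimal_sufficient E1 T1 \<and> minimal_sufficient E2 T2 \<and>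
           bij_betw h (T2 ` outcomes E2) (T1 ` outcomes E1) \<and>
           (\<forall>\<theta>. \<forall>t\<in>T2 ` outcomes E2. induced_mass E1 T1 \<theta> (h t) = induced_mass E2 T2 \<theta> t) \<and>
           T1 x1 = h (T2 x2))}"

definition ancillary :: "('p, 'x) model \<Rightarrow> ('x \<Rightarrow> 'x) \<Rightarrow> bool" where
  "ancillary E A \<longleftrightarrow> (\<forall>\<theta> \<theta>'. map_pmf A (distr E \<theta>) = map_pmf A (distr E \<theta>'))"

definition fibre :: "('p, 'x) model \<Rightarrow> ('x \<Rightarrow> 'x) \<Rightarrow> 'x \<Rightarrow> 'x set" where
  "fibre E A a = {x \<in> outcomes E. A x = a}"

text \<open>
  The last disjunction: the ordinary branch (codes are inherited), or the mixed-experiment branch.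
\<close>

definition conditions_to :: "('p, 'x) base \<Rightarrow> ('p, 'x) base \<Rightarrow> bool" where
  "conditions_to = (\<lambda>(E1, x1) (E2, x2).
     \<exists>A A0 \<iota>.
       A ` outcomes E1 \<subseteq> A0 \<and> ancillary E1 A \<and>
       (\<forall>\<theta>. Prob E1 \<theta> (fibre E1 A (A x1)) > 0) \<and>
       inj_on \<iota> (outcomes E2) \<and> \<iota> ` outcomes E2 = fibre E1 A (A x1) \<and> \<iota> x2 = x1 \<and>
       (\<forall>\<theta>. \<forall>y\<in>outcomes E2.
          mass E2 \<theta> y = mass E1 \<theta> (\<iota> y) / Prob E1 \<theta> (fibre E1 A (A x1))) \<and>
       ((\<forall>y\<in>outcomes E2. code E1 (\<iota> y) = code E2 y) \<or>
        (A ` outcomes E1 = A0 \<and> (\<exists>a\<in>A0. \<exists>b\<in>A0. a \<noteq> b))))"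

definition conditionality_rel :: "('p, 'x) base rel" where
  "conditionality_rel =
     {(I1, I2). I1 \<in> inference_bases \<and> I2 \<in> inference_bases \<and>
        (conditions_to I1 I2 \<or> conditions_to I2 I1)}"

definition preserves :: "(('p, 'x) base \<times> 'a) set \<Rightarrow> ('p, 'x) base rel \<Rightarrow> bool" where
  "preserves Ev D \<longleftrightarrow> (\<forall>I1 I2. (I1, I2) \<in> D \<longrightarrow> Ev `` {I1} = Ev `` {I2})"

definition procedures :: "('p, 'x) base rel \<Rightarrow> 'a set \<Rightarrow> (('p, 'x) base \<times> 'a) set set" where
  "procedures D \<A> = {Ev. Ev \<subseteq> inference_bases \<times> \<A> \<and> preserves Ev D}"

end

theory Submission
  imports Defs
begin

text \<open>
  Enlarging a relation shrinks the class of procedures that preserve it.  Both the conditionality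
  and the sufficiency relation are contained in the likelihood relation, since conditioning on an
  ancillary and reducing by a sufficient statistic only multiply the likelihood function by a
  positive constant.

  The converse for conditionality rests on one construction
  (\<open>likelihood_rel_subset_conditionality_rel_relcomp\<close>): inference bases \<open>(E1, x1)\<close> and \<open>(E2, x2)\<close>
  with proportional likelihoods are both obtained by conditioning one mixture of \<open>E1\<close> and \<open>E2\<close> at
  one and the same outcome \<open>x2\<close>.  With the right weights \<open>x1\<close> and \<open>x2\<close> have equal mass in the mixture
  whatever the parameter.  Hence the event that consists of \<open>x2\<close> and of all outcomes of \<open>E1\<close> except
  \<open>x1\<close> is as ancillary as the first component of the mixture, and conditioning on it yields a
  relabelled \<open>E1\<close> with \<open>x2\<close> in the role of \<open>x1\<close>.  These events and their complements are non-empty,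
  so the indicators are mixed-experiment ancillaries and the outcome codes do not interfere.  A
  procedure that respects conditionality therefore respects likelihood as well.

  Sufficiency is weaker, because it compares whole experiments and not only the observed likelihood
  function.  Related bases have equivalent reduced experiments, so the property of carrying no
  information about the parameter is shared by both or by neither
  (\<open>sufficiency_rel_preserves_sufficient_const\<close>).  Likelihood does not respect this property once
  there are two parameter values (\<open>likelihood_rel_not_preserves_sufficient_const\<close>), and a procedure
  that has a value to report can display it.  With one parameter value all experiments carry no
  information and all inference bases are related by sufficiency.
\<close>

section \<open>Both relations refine the likelihood relation\<close>

lemma procedures_antimono:
  assumes "D \<subseteq> D'"
  shows "procedures D' \<A> \<subseteq> procedures D \<A>"
  using assms unfolding procedures_def preserves_def by blast

lemma procedures_relcomp_subset: "procedures D \<A> \<subseteq> procedures (D O D) \<A>"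
  unfolding procedures_def preserves_def by blast

lemma likelihood_rel_sym:
  assumes "(I1, I2) \<in> likelihood_rel"
  shows "(I2, I1) \<in> likelihood_rel"
proof -
  obtain E1 x1 E2 x2 where I: "I1 = (E1, x1)" "I2 = (E2, x2)"
    by (cases I1, cases I2)
  with assms obtain k where b: "I1 \<in> inference_bases" "I2 \<in> inference_bases" and k: "k > 0"
    and eq: "\<And>\<theta>. mass E1 \<theta> x1 = k * mass E2 \<theta> x2"
    unfolding likelihood_rel_def by auto
  have "\<forall>\<theta>. mass E2 \<theta> x2 = inverse k * mass E1 \<theta> x1" using eq k by simp
  moreover have "inverse k > 0" using k by simp
  ultimately show ?thesis using b I unfolding likelihood_rel_def by blast
qed

lemma set_pmf_subset_outcomes:
  assumes "is_model E"
  shows "set_pmf (distr E \<theta>) \<subseteq> outcomes E"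
  using assms unfolding is_model_def by blast

lemma Prob_fibre:
  assumes "is_model E"
  shows "Prob E \<theta> (fibre E A a) = pmf (map_pmf A (distr E \<theta>)) a"
proof -
  have "fibre E A a \<inter> set_pmf (distr E \<theta>) = (A -` {a}) \<inter> set_pmf (distr E \<theta>)"
    using set_pmf_subset_outcomes[OF assms] unfolding fibre_def by auto
  then show ?thesis by (metis measure_Int_set_pmf pmf_map)
qed

text \<open>
  Ancillarity makes the probability of the conditioning event free of the parameter; this probability
  is the factor between the two likelihood functions.
\<close>

lemma conditions_to_imp_likelihood_rel:
  assumes "I1 \<in> inference_bases" "I2 \<in> inference_bases" "conditions_to I1 I2"
  shows "(I1, I2) \<in> likelihood_rel"
proof -
  obtain E1 x1 E2 x2 where I: "I1 = (E1, x1)" "I2 = (E2, x2)"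
    by (cases I1, cases I2)
  have m: "is_model E1" "x2 \<in> outcomes E2"
    using assms(1,2) unfolding I inference_bases_def by auto
  from assms(3) obtain A \<iota> where anc: "ancillary E1 A"
    and pos: "\<And>\<theta>. Prob E1 \<theta> (fibre E1 A (A x1)) > 0" and "\<iota> x2 = x1"
    and mass: "\<And>\<theta> y. y \<in> outcomes E2 \<Longrightarrow>
      mass E2 \<theta> y = mass E1 \<theta> (\<iota> y) / Prob E1 \<theta> (fibre E1 A (A x1))"
    unfolding I conditions_to_def prod.case
    by (elim exE conjE) (rule that, assumption, erule spec, assumption, drule spec, erule (1) bspec)
  define c where "c = Prob E1 undefined (fibre E1 A (A x1))"
  have c: "Prob E1 \<theta> (fibre E1 A (A x1)) = c" for \<theta>
  proof -
    have "map_pmf A (distr E1 \<theta>) = map_pmf A (distr E1 undefined)"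
      using anc unfolding ancillary_def by blast
    then show ?thesis by (simp only: c_def Prob_fibre[OF m(1)])
  qed
  have "c > 0" using pos[of undefined] unfolding c_def .
  moreover have "mass E1 \<theta> x1 = c * mass E2 \<theta> x2" for \<theta>
    using mass[OF m(2), of \<theta>] \<open>\<iota> x2 = x1\<close> \<open>c > 0\<close> unfolding c by simp
  ultimately show ?thesis using assms(1,2) unfolding I likelihood_rel_def by blast
qed

lemma conditionality_rel_subset_likelihood_rel: "conditionality_rel \<subseteq> likelihood_rel"
proof (rule subrelI)
  fix I1 I2 :: "('a, 'b) base"
  assume "(I1, I2) \<in> conditionality_rel"
  then have "I1 \<in> inference_bases" "I2 \<in> inference_bases"
    and "conditions_to I1 I2 \<or> conditions_to I2 I1"
    unfolding conditionality_rel_def by auto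
  then show "(I1, I2) \<in> likelihood_rel"
    using conditions_to_imp_likelihood_rel likelihood_rel_sym by blast
qed

text \<open>
  The factor in the definition of sufficiency is positive because some parameter value gives the
  outcome positive mass.
\<close>

lemma sufficient_factor_pos:
  assumes "is_model E" "sufficient E T" "x \<in> outcomes E"
  obtains c where "c > 0" "\<And>\<theta>. mass E \<theta> x = c * induced_mass E T \<theta> (T x)"
proof -
  from assms obtain g where g: "\<And>\<theta>. mass E \<theta> x = g x * induced_mass E T \<theta> (T x)"
    unfolding sufficient_def by blast
  obtain \<theta> where "mass E \<theta> x > 0" using assms unfolding is_model_def by blast
  moreover have "induced_mass E T \<theta> (T x) \<ge> 0" unfolding induced_mass_def by (simp add: sum_nonneg)
  ultimately have "g x > 0" using g[of \<theta>] by (simp add: zero_less_mult_iff)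
  with g show thesis using that by blast
qed

lemma sufficiency_relE:
  assumes "((E1, x1), (E2, x2)) \<in> sufficiency_rel"
  obtains T1 T2 h where "(E1, x1) \<in> inference_bases" "(E2, x2) \<in> inference_bases"
    "minimal_sufficient E1 T1" "minimal_sufficient E2 T2"
    "bij_betw h (T2 ` outcomes E2) (T1 ` outcomes E1)"
    "\<forall>\<theta>. \<forall>t\<in>T2 ` outcomes E2. induced_mass E1 T1 \<theta> (h t) = induced_mass E2 T2 \<theta> t"
    "T1 x1 = h (T2 x2)"
  using assms unfolding sufficiency_rel_def mem_Collect_eq prod.case
  by (elim exE conjE) (rule that)

lemma sufficiency_rel_subset_likelihood_rel: "sufficiency_rel \<subseteq> likelihood_rel"
proof (rule subrelI)
  fix I1 I2 :: "('a, 'b) base"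
  assume S: "(I1, I2) \<in> sufficiency_rel"
  obtain E1 x1 E2 x2 where I: "I1 = (E1, x1)" "I2 = (E2, x2)"
    by (cases I1, cases I2)
  from S[unfolded I] obtain T1 T2 h where b: "I1 \<in> inference_bases" "I2 \<in> inference_bases"
    and min: "minimal_sufficient E1 T1" "minimal_sufficient E2 T2"
    and eq: "\<forall>\<theta>. \<forall>t\<in>T2 ` outcomes E2. induced_mass E1 T1 \<theta> (h t) = induced_mass E2 T2 \<theta> t"
    and h: "T1 x1 = h (T2 x2)"
    unfolding I by (rule sufficiency_relE)
  have suff: "sufficient E1 T1" "sufficient E2 T2"
    using min unfolding minimal_sufficient_def by simp_all
  have m: "is_model E1" "x1 \<in> outcomes E1" "is_model E2" "x2 \<in> outcomes E2"
    using b unfolding I inference_bases_def by auto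
  obtain c where c: "c > 0" "\<And>\<theta>. mass E1 \<theta> x1 = c * induced_mass E1 T1 \<theta> (T1 x1)"
    using sufficient_factor_pos[OF m(1) suff(1) m(2)] by blast
  obtain d where d: "d > 0" "\<And>\<theta>. mass E2 \<theta> x2 = d * induced_mass E2 T2 \<theta> (T2 x2)"
    using sufficient_factor_pos[OF m(3) suff(2) m(4)] by blast
  have "mass E1 \<theta> x1 = (c / d) * mass E2 \<theta> x2" for \<theta>
    using c(2)[of \<theta>] d eq h m(4) by simp
  moreover have "c / d > 0" using c(1) d(1) by simp
  ultimately show "(I1, I2) \<in> likelihood_rel"
    using b unfolding I likelihood_rel_def by blast
qed

section \<open>Proportional likelihoods are joined by two conditionings\<close>

definition enumeration_code :: "'x set \<Rightarrow> 'x \<Rightarrow> nat" where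
  "enumeration_code X = restrict (to_nat_on X) X"

lemma enumeration_code:
  assumes "finite X"
  shows "enumeration_code X \<in> extensional X" "inj_on (enumeration_code X) X"
proof -
  have "inj_on (to_nat_on X) X" using assms by (intro inj_on_to_nat_on countable_finite)
  then show "inj_on (enumeration_code X) X"
    unfolding enumeration_code_def by (simp add: inj_on_restrict_eq)
qed (simp add: enumeration_code_def)

text \<open>
  An event whose probability is free of the parameter makes its indicator ancillary.  A proper event
  yields a two-valued indicator, so the mixed-experiment branch applies: one may condition on
  the event and relabel both the outcomes and their codes at will.
\<close>

lemma conditions_to_event:
  fixes E1 E2 :: "('p, 'x) model"
  assumes two: "\<exists>a b :: 'x. a \<noteq> b"
    and F: "F \<subset> outcomes E1"
    and prob: "\<And>\<theta>. Prob E1 \<theta> F = w" "w > 0"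
    and \<iota>: "bij_betw \<iota> (outcomes E2) F" "x2 \<in> outcomes E2"
    and mass: "\<And>\<theta> y. y \<in> outcomes E2 \<Longrightarrow> mass E1 \<theta> (\<iota> y) = w * mass E2 \<theta> y"
  shows "conditions_to (E1, \<iota> x2) (E2, x2)"
proof -
  obtain a b :: 'x where ab: "a \<noteq> b" using two by blast
  define A where "A x = (if x \<in> F then a else b)" for x
  have x1: "\<iota> x2 \<in> F" using \<iota> by (auto simp: bij_betw_def)
  have fib: "fibre E1 A (A (\<iota> x2)) = F"
    using F x1 ab unfolding fibre_def A_def by auto
  have "map_pmf A (distr E1 \<theta>) = map_pmf (\<lambda>q. if q then a else b) (bernoulli_pmf w)" for \<theta>
  proof -
    have "map_pmf (\<lambda>x. x \<in> F) (distr E1 \<theta>) = bernoulli_pmf w"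
    proof (rule pmf_eqI)
      fix q
      have 1: "0 \<le> w" "w \<le> 1" using prob by (auto simp flip: prob(1)[of \<theta>])
      have T: "(\<lambda>x. x \<in> F) -` {True} = F" and Fl: "(\<lambda>x. x \<in> F) -` {False} = - F" by auto
      have "Prob E1 \<theta> (- F) = 1 - w"
        using measure_pmf.prob_compl[of F "distr E1 \<theta>"] prob by (simp add: Compl_eq_Diff_UNIV)
      then show "pmf (map_pmf (\<lambda>x. x \<in> F) (distr E1 \<theta>)) q = pmf (bernoulli_pmf w) q"
        using 1 prob(1) by (cases q) (simp_all add: pmf_map T Fl)
    qed
    then have "map_pmf (\<lambda>q. if q then a else b) (bernoulli_pmf w)
        = map_pmf (\<lambda>q. if q then a else b) (map_pmf (\<lambda>x. x \<in> F) (distr E1 \<theta>))"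
      by simp
    also have "\<dots> = map_pmf A (distr E1 \<theta>)" by (simp add: map_pmf_comp A_def [abs_def])
    finally show ?thesis ..
  qed
  then have anc: "ancillary E1 A" unfolding ancillary_def by simp
  have "a \<in> A ` outcomes E1" "b \<in> A ` outcomes E1"
    using F x1 by (force simp: A_def)+
  then have "\<exists>s\<in>A ` outcomes E1. \<exists>t\<in>A ` outcomes E1. s \<noteq> t" using ab by blast
  moreover have "inj_on \<iota> (outcomes E2)" "\<iota> ` outcomes E2 = F"
    using \<iota> by (auto simp: bij_betw_def)
  ultimately show ?thesis
    unfolding conditions_to_def prod.case
    using anc prob mass
    by (intro exI[of _ A] exI[of _ "A ` outcomes E1"] exI[of _ \<iota>]) (auto simp: fib)
qed

text \<open>
  The experiment that performs \<open>E1\<close> with probability \<open>w\<close> and \<open>E2\<close> otherwise.  The relabelling \<open>j\<close>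
  is there to keep the two sample spaces apart, so that the outcome reveals which experiment was
  performed.
\<close>

definition mixture :: "real \<Rightarrow> ('p, 'x) model \<Rightarrow> ('x \<Rightarrow> 'x) \<Rightarrow> ('p, 'x) model \<Rightarrow> ('p, 'x) model" where
  "mixture w E1 j E2 =
     \<lparr>outcomes = outcomes E1 \<union> j ` outcomes E2,
      distr = (\<lambda>\<theta>. bernoulli_pmf w \<bind>
        (\<lambda>q. if q then distr E1 \<theta> else map_pmf j (distr E2 \<theta>))),
      code = enumeration_code (outcomes E1 \<union> j ` outcomes E2)\<rparr>"

lemma outcomes_mixture: "outcomes (mixture w E1 j E2) = outcomes E1 \<union> j ` outcomes E2"
  by (simp add: mixture_def)

context
  fixes E1 E2 :: "('p, 'x) model" and j :: "'x \<Rightarrow> 'x" and w :: real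
  assumes models: "is_model E1" "is_model E2"
    and j: "inj_on j (outcomes E2)" "outcomes E1 \<inter> j ` outcomes E2 = {}"
    and w: "0 < w" "w < 1"
begin

lemma mass_mixture:
  "mass (mixture w E1 j E2) \<theta> z = w * mass E1 \<theta> z + (1 - w) * pmf (map_pmf j (distr E2 \<theta>)) z"
  using w by (simp add: mixture_def pmf_bind)

lemma mass_mixture_left:
  assumes "y \<in> outcomes E1"
  shows "mass (mixture w E1 j E2) \<theta> y = w * mass E1 \<theta> y"
proof -
  have "y \<notin> set_pmf (map_pmf j (distr E2 \<theta>))"
    using set_pmf_subset_outcomes[OF models(2)] assms j(2) by auto
  then have "pmf (map_pmf j (distr E2 \<theta>)) y = 0" by (rule pmf_eq_0_set_pmf[THEN iffD2])
  then show ?thesis by (simp add: mass_mixture)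
qed

lemma mass_mixture_right:
  assumes "y \<in> outcomes E2"
  shows "mass (mixture w E1 j E2) \<theta> (j y) = (1 - w) * mass E2 \<theta> y"
proof -
  note s = models[THEN set_pmf_subset_outcomes]
  have "j y \<notin> set_pmf (distr E1 \<theta>)" using s assms j(2) by blast
  then have "mass E1 \<theta> (j y) = 0" by (rule pmf_eq_0_set_pmf[THEN iffD2])
  moreover have "pmf (map_pmf j (distr E2 \<theta>)) (j y) = mass E2 \<theta> y"
  proof -
    have "(j -` {j y}) \<inter> set_pmf (distr E2 \<theta>) = {y} \<inter> set_pmf (distr E2 \<theta>)"
      using s(2)[of \<theta>] assms j(1) by (auto simp: inj_on_def subset_iff)
    then have "Prob E2 \<theta> (j -` {j y}) = Prob E2 \<theta> {y}" by (metis measure_Int_set_pmf)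
    then show ?thesis by (simp add: pmf_map measure_pmf_single)
  qed
  ultimately show ?thesis by (simp add: mass_mixture)
qed

lemma is_model_mixture: "is_model (mixture w E1 j E2)"
proof -
  have fin: "finite (outcomes E1 \<union> j ` outcomes E2)" and ne: "outcomes E1 \<noteq> {}"
    using models unfolding is_model_def by auto
  have sub: "set_pmf (distr (mixture w E1 j E2) \<theta>) \<subseteq> outcomes E1 \<union> j ` outcomes E2" for \<theta>
    using models[THEN set_pmf_subset_outcomes, of \<theta>] by (auto simp: mixture_def subset_iff split: if_splits)
  have "\<exists>\<theta>. mass (mixture w E1 j E2) \<theta> z > 0" if z: "z \<in> outcomes E1 \<union> j ` outcomes E2" for z
    using z
  proof
    assume "z \<in> outcomes E1"
    moreover then obtain \<theta> where "mass E1 \<theta> z > 0" using models unfolding is_model_def by blast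
    ultimately show ?thesis using w mass_mixture_left by (metis mult_pos_pos)
  next
    assume "z \<in> j ` outcomes E2"
    then obtain y where y: "y \<in> outcomes E2" "z = j y" by blast
    then obtain \<theta> where "mass E2 \<theta> y > 0" using models unfolding is_model_def by blast
    then show ?thesis using w y mass_mixture_right
      by (metis diff_gt_0_iff_gt mult_pos_pos)
  qed
  with fin ne sub enumeration_code[OF fin] show ?thesis
    unfolding is_model_def outcomes_mixture by (simp add: mixture_def)
qed

end

lemma sum_mass_outcomes:
  assumes "is_model E"
  shows "(\<Sum>x\<in>outcomes E. mass E \<theta> x) = 1"
  using assms unfolding is_model_def by (simp add: sum_pmf_eq_1)

text \<open>
  Conditioning and relabelling is possible as soon as \<open>\<iota>\<close> maps the sample space of \<open>E2\<close> onto a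
  proper event on which the masses of \<open>E1\<close> are those of \<open>E2\<close> up to one factor \<open>w\<close>: summation shows
  that \<open>w\<close> is the probability of the event, whatever the parameter.
\<close>

lemma conditions_to_proportional:
  fixes E1 E2 :: "('p, 'x) model"
  assumes two: "\<exists>a b :: 'x. a \<noteq> b" and E2: "is_model E2" "x2 \<in> outcomes E2"
    and \<iota>: "inj_on \<iota> (outcomes E2)" "\<iota> ` outcomes E2 \<subset> outcomes E1"
    and mass: "\<And>\<theta> y. y \<in> outcomes E2 \<Longrightarrow> mass E1 \<theta> (\<iota> y) = w * mass E2 \<theta> y" and w: "w > 0"
  shows "conditions_to (E1, \<iota> x2) (E2, x2)"
proof (rule conditions_to_event[OF two \<iota>(2) _ w])
  fix \<theta>
  have "finite (outcomes E2)" using E2 unfolding is_model_def by blast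
  then have "Prob E1 \<theta> (\<iota> ` outcomes E2) = (\<Sum>y\<in>outcomes E2. mass E1 \<theta> (\<iota> y))"
    using \<iota>(1) by (simp add: measure_measure_pmf_finite sum.reindex)
  also have "\<dots> = w * (\<Sum>y\<in>outcomes E2. mass E2 \<theta> y)"
    using mass by (simp add: sum_distrib_left)
  finally show "Prob E1 \<theta> (\<iota> ` outcomes E2) = w" using sum_mass_outcomes[OF E2(1)] by simp
qed (use \<iota>(1) E2(2) mass in \<open>auto simp: bij_betw_def\<close>)

lemma disjoint_copy:
  fixes X Y :: "'x set"
  assumes "infinite (UNIV :: 'x set)" "finite X" "finite Y"
  obtains j :: "'x \<Rightarrow> 'x" where "inj_on j Y" "X \<inter> j ` Y = {}"
proof -
  have "infinite (- X)" using assms by (simp add: Compl_eq_Diff_UNIV)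
  then obtain B where B: "finite B" "card B = card Y" "B \<subseteq> - X"
    using infinite_arbitrarily_large by blast
  then obtain j where "bij_betw j Y B" using finite_same_card_bij assms(3) by metis
  then show thesis using B(3) by (intro that[of j]) (auto simp: bij_betw_def)
qed

text \<open>
  Let \<open>E\<close> be the mixture of \<open>E1\<close> and \<open>E2\<close> with the weights that give \<open>x1\<close> and \<open>x2\<close> the same mass for
  every parameter.  Conditioning \<open>E\<close> on the second component takes \<open>x2\<close>, seen in \<open>E\<close>, to \<open>x2\<close> in
  \<open>E2\<close>.  Exchanging \<open>x1\<close> for \<open>x2\<close> in the first component changes no masses; so conditioning on the
  exchanged component yields \<open>E1\<close> again, but now \<open>x2\<close>, seen in \<open>E\<close>, is taken to \<open>x1\<close> in \<open>E1\<close>.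
\<close>

lemma likelihood_rel_subset_conditionality_rel_relcomp:
  assumes inf: "infinite (UNIV :: 'x set)"
  shows "(likelihood_rel :: ('p, 'x) base rel) \<subseteq> conditionality_rel O conditionality_rel"
proof (rule subrelI)
  fix I1 I2 :: "('p, 'x) base"
  assume L: "(I1, I2) \<in> likelihood_rel"
  obtain E1 x1 E2 x2 where I: "I1 = (E1, x1)" "I2 = (E2, x2)"
    by (cases I1, cases I2)
  from L obtain k where b: "I1 \<in> inference_bases" "I2 \<in> inference_bases"
    and k: "k > 0" "\<And>\<theta>. mass E1 \<theta> x1 = k * mass E2 \<theta> x2"
    unfolding I likelihood_rel_def by auto
  have m: "is_model E1" "x1 \<in> outcomes E1" "is_model E2" "x2 \<in> outcomes E2"
    using b unfolding I inference_bases_def by auto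
  have two: "\<exists>a b :: 'x. a \<noteq> b" using inf by (metis (full_types) UNIV_eq_I finite.simps insertI1)
  have "finite (outcomes E1)" "finite (outcomes E2)" using m unfolding is_model_def by auto
  then obtain j where j: "inj_on j (outcomes E2)" "outcomes E1 \<inter> j ` outcomes E2 = {}"
    using disjoint_copy[OF inf] by blast
  \<comment> \<open>The solution of \<open>w * k = 1 - w\<close>, which equates the masses of \<open>x1\<close> and \<open>x2\<close> in the mixture.\<close>
  define w where "w = 1 / (1 + k)"
  have w: "0 < w" "w < 1" and wk: "w * k = 1 - w" using k(1) by (auto simp: w_def field_simps)
  define E where "E = mixture w E1 j E2"
  note ctxt = m(1) m(3) j w
  have left: "mass E \<theta> y = w * mass E1 \<theta> y" if "y \<in> outcomes E1" for \<theta> y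
    unfolding E_def by (rule mass_mixture_left[OF ctxt that])
  have right: "mass E \<theta> (j y) = (1 - w) * mass E2 \<theta> y" if "y \<in> outcomes E2" for \<theta> y
    unfolding E_def by (rule mass_mixture_right[OF ctxt that])
  have out: "outcomes E = outcomes E1 \<union> j ` outcomes E2" unfolding E_def by (rule outcomes_mixture)
  have base: "(E, j x2) \<in> inference_bases"
    using is_model_mixture[OF ctxt] out m(4) unfolding inference_bases_def E_def[symmetric] by auto
  have "j ` outcomes E2 \<subset> outcomes E" using m(2) j(2) out by blast
  then have "conditions_to (E, j x2) (E2, x2)"
    using w m j right by (intro conditions_to_proportional[OF two, where w = "1 - w"]) auto
  moreover have "conditions_to (E, j x2) (E1, x1)"
  proof -
    define \<iota> where "\<iota> = (\<lambda>y. y)(x1 := j x2)"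
    have "inj_on \<iota> (outcomes E1)" using j(2) m(4) unfolding \<iota>_def inj_on_def by auto
    moreover have "x1 \<notin> \<iota> ` outcomes E1" "\<iota> ` outcomes E1 \<subseteq> outcomes E"
      using j(2) m(2,4) unfolding \<iota>_def out by auto
    moreover then have "\<iota> ` outcomes E1 \<subset> outcomes E" using m(2) out by auto
    moreover have "mass E \<theta> (\<iota> y) = w * mass E1 \<theta> y" if "y \<in> outcomes E1" for \<theta> y
      using left[OF that] right[OF m(4)] k(2) wk by (simp add: \<iota>_def flip: mult.assoc)
    ultimately have "conditions_to (E, \<iota> x1) (E1, x1)"
      using w m by (intro conditions_to_proportional[OF two])
    then show ?thesis by (simp add: \<iota>_def)
  qed
  ultimately have "(I1, (E, j x2)) \<in> conditionality_rel" "((E, j x2), I2) \<in> conditionality_rel"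
    using b base unfolding conditionality_rel_def I by auto
  then show "(I1, I2) \<in> conditionality_rel O conditionality_rel" by blast
qed

section \<open>Strictness for the sufficiency relation\<close>

lemma induced_mass_const:
  assumes "is_model E"
  shows "induced_mass E (\<lambda>_. u) \<theta> u = 1"
  unfolding induced_mass_def using sum_mass_outcomes[OF assms] by simp

text \<open>
  A constant statistic induces a point mass, from which the parameter has disappeared.  Its
  sufficiency therefore characterises the experiments that carry no information.
\<close>

lemma sufficient_const_iff:
  assumes "is_model E"
  shows "sufficient E (\<lambda>_. u) \<longleftrightarrow> (\<forall>\<theta> \<theta>'. \<forall>x\<in>outcomes E. mass E \<theta> x = mass E \<theta>' x)"
proof
  assume R: "\<forall>\<theta> \<theta>'. \<forall>x\<in>outcomes E. mass E \<theta> x = mass E \<theta>' x"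
  show "sufficient E (\<lambda>_. u)"
    unfolding sufficient_def induced_mass_const[OF assms]
    using R by (intro exI[of _ "mass E undefined"]) auto
qed (auto simp: sufficient_def induced_mass_const[OF assms])

lemma sufficient_cong:
  assumes "\<And>x. x \<in> outcomes E \<Longrightarrow> T x = U x"
  shows "sufficient E T \<longleftrightarrow> sufficient E U"
proof -
  have "{x \<in> outcomes E. T x = t} = {x \<in> outcomes E. U x = t}" for t using assms by auto
  then have "induced_mass E T = induced_mass E U" by (simp add: induced_mass_def fun_eq_iff)
  then show ?thesis using assms unfolding sufficient_def by simp
qed

text \<open>
  When a constant is sufficient, every minimal sufficient statistic takes a single value, and the
  bijection between the reduced sample spaces transports this to the related experiment.
\<close>

lemma sufficiency_rel_preserves_sufficient_const:
  assumes S: "((E1, x1), (E2, x2)) \<in> sufficiency_rel"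
  shows "sufficient E1 (\<lambda>_. u) \<longleftrightarrow> sufficient E2 (\<lambda>_. u)"
proof -
  from S obtain T1 T2 h where b: "(E1, x1) \<in> inference_bases" "(E2, x2) \<in> inference_bases"
    and T: "minimal_sufficient E1 T1" "minimal_sufficient E2 T2"
    and h: "bij_betw h (T2 ` outcomes E2) (T1 ` outcomes E1)"
    by (rule sufficiency_relE)
  have m: "is_model E1" "is_model E2" using b unfolding inference_bases_def by auto
  have *: "sufficient E (\<lambda>_. u) \<longleftrightarrow> card (T ` outcomes E) = 1"
    if E: "is_model E" and T: "minimal_sufficient E T" for E :: "('a, 'b) model" and T
  proof
    assume "sufficient E (\<lambda>_. u)"
    then obtain \<phi> where "\<forall>x\<in>outcomes E. T x = \<phi> u"
      using T unfolding minimal_sufficient_def by blast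
    moreover have "outcomes E \<noteq> {}" using E unfolding is_model_def by blast
    ultimately have "T ` outcomes E = {\<phi> u}" by auto
    then show "card (T ` outcomes E) = 1" by simp
  next
    assume "card (T ` outcomes E) = 1"
    then obtain t where "T ` outcomes E = {t}" using card_1_singletonE by blast
    then have "\<And>x. x \<in> outcomes E \<Longrightarrow> T x = t" by auto
    then have "sufficient E (\<lambda>_. t)"
      using sufficient_cong[of E T "\<lambda>_. t"] T unfolding minimal_sufficient_def by blast
    then show "sufficient E (\<lambda>_. u)" by (simp add: sufficient_const_iff[OF E])
  qed
  show ?thesis using *[OF m(1) T(1)] *[OF m(2) T(2)] bij_betw_same_card[OF h] by simp
qed

text \<open>
  A point mass carries no information, yet its only outcome has the same likelihood function, up to
  a factor, as an uninformative outcome of an informative experiment: \<open>u\<close> has probability one half,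
  and the other outcome, \<open>v\<close> or \<open>z\<close>, tells whether the parameter is \<open>\<theta>0\<close>.
\<close>

lemma likelihood_rel_not_preserves_sufficient_const:
  assumes inf: "infinite (UNIV :: 'x set)" and card: "CARD('p::finite) \<ge> 2"
  obtains E1 E2 :: "('p::finite, 'x) model" and x1 x2 where "((E1, x1), (E2, x2)) \<in> likelihood_rel"
    "sufficient E1 (\<lambda>_. c)" "\<not> sufficient E2 (\<lambda>_. c)"
proof -
  obtain \<theta>0 \<theta>1 :: 'p where \<theta>: "\<theta>0 \<noteq> \<theta>1"
    using card by (auto simp: numeral_2_eq_2 card_le_Suc_iff)
  obtain B :: "'x set" where "card B = 3" using infinite_arbitrarily_large[OF inf] by blast
  then obtain u v z :: 'x where d: "u \<noteq> v" "u \<noteq> z" "v \<noteq> z" by (auto simp: card_3_iff)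
  define E1 :: "('p, 'x) model" where
    "E1 = \<lparr>outcomes = {u}, distr = \<lambda>_. return_pmf u, code = enumeration_code {u}\<rparr>"
  define E2 :: "('p, 'x) model" where
    "E2 = \<lparr>outcomes = {u, v, z}, distr = \<lambda>\<theta>. pmf_of_set {u, if \<theta> = \<theta>0 then v else z},
           code = enumeration_code {u, v, z}\<rparr>"
  have mass2: "mass E2 \<theta> y = (if y = u \<or> y = (if \<theta> = \<theta>0 then v else z) then 1 / 2 else 0)" for \<theta> y
    using d by (auto simp: E2_def pmf_of_set indicator_def)
  have m1: "is_model E1" using enumeration_code[of "{u}"] by (simp add: is_model_def E1_def)
  have "\<exists>\<theta>. mass E2 \<theta> y > 0" if "y \<in> {u, v, z}" for y
    using that \<theta> by (auto simp: mass2 intro: exI[of _ \<theta>0] exI[of _ \<theta>1])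
  moreover have "set_pmf (distr E2 \<theta>) \<subseteq> {u, v, z}" for \<theta> by (auto simp: E2_def)
  ultimately have m2: "is_model E2"
    using enumeration_code[of "{u, v, z}"] by (simp add: is_model_def) (simp add: E2_def)
  have "\<forall>\<theta>. mass E1 \<theta> u = 2 * mass E2 \<theta> u" by (simp add: mass2) (simp add: E1_def)
  then have L: "((E1, u), (E2, u)) \<in> likelihood_rel"
    using m1 m2 unfolding likelihood_rel_def inference_bases_def
    by (auto simp: E1_def E2_def intro!: exI[of _ "2::real"])
  have suff: "sufficient E1 (\<lambda>_. c)"
    unfolding sufficient_const_iff[OF m1] by (simp add: E1_def)
  have "v \<in> outcomes E2" by (simp add: E2_def)
  moreover have "mass E2 \<theta>0 v \<noteq> mass E2 \<theta>1 v" using d \<theta> by (simp add: mass2)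
  ultimately have "\<not> sufficient E2 (\<lambda>_. c)"
    unfolding sufficient_const_iff[OF m2] by metis
  with L suff show thesis by (rule that)
qed

text \<open>
  With a single parameter value every experiment carries no information, so the constant is minimal
  sufficient everywhere and all experiments reduce to the same one.
\<close>

lemma sufficiency_rel_single_parameter:
  assumes "CARD('p::finite) = 1"
  shows "(sufficiency_rel :: ('p, 'x) base rel) = inference_bases \<times> inference_bases"
proof -
  have \<theta>: "\<theta> = \<theta>'" for \<theta> \<theta>' :: 'p
    using assms by (metis (full_types) UNIV_I card_1_singletonE singletonD)
  have min: "minimal_sufficient E (\<lambda>_. undefined)" if "is_model E" for E :: "('p, 'x) model"
  proof -
    have "\<forall>\<theta> \<theta>'. \<forall>x\<in>outcomes E. mass E \<theta> x = mass E \<theta>' x" using \<theta> by metis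
    then show ?thesis
      unfolding minimal_sufficient_def by (auto simp: sufficient_const_iff[OF that])
  qed
  have "((E1, x1), (E2, x2)) \<in> sufficiency_rel"
    if b: "(E1, x1) \<in> inference_bases" "(E2, x2) \<in> inference_bases"
    for E1 E2 :: "('p, 'x) model" and x1 x2
  proof -
    have m: "is_model E1" "is_model E2" "outcomes E1 \<noteq> {}" "outcomes E2 \<noteq> {}"
      using b unfolding inference_bases_def by auto
    show ?thesis
      unfolding sufficiency_rel_def using b m min
      by (auto intro!: exI[of _ "\<lambda>_. undefined"] simp: induced_mass_const bij_betw_def inj_on_def)
  qed
  then show ?thesis unfolding sufficiency_rel_def by auto
qed

text \<open>
  The separating procedure reports a fixed value \<open>a\<close> for the experiments that carry no information,
  and nothing for all others.
\<close>

lemma procedures_likelihood_rel_strict_subset_iff: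
  fixes \<A> :: "'a set"
  assumes inf: "infinite (UNIV :: 'x set)"
  shows "procedures (likelihood_rel :: ('p::finite, 'x) base rel) \<A> \<subset> procedures sufficiency_rel \<A>
    \<longleftrightarrow> CARD('p) \<ge> 2 \<and> \<A> \<noteq> {}" (is "?L \<subset> ?S \<longleftrightarrow> _")
proof
  assume strict: "?L \<subset> ?S"
  have "\<A> \<noteq> {}"
  proof
    assume "\<A> = {}"
    then have "?S \<subseteq> ?L" unfolding procedures_def preserves_def by auto
    then show False using strict by blast
  qed
  moreover have "CARD('p) \<noteq> 1"
  proof
    assume "CARD('p) = 1"
    then have "(likelihood_rel :: ('p, 'x) base rel) \<subseteq> sufficiency_rel"
      unfolding sufficiency_rel_single_parameter[OF \<open>CARD('p) = 1\<close>] likelihood_rel_def by auto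
    then show False using strict procedures_antimono by blast
  qed
  moreover have "CARD('p) > 0" by simp
  ultimately show "CARD('p) \<ge> 2 \<and> \<A> \<noteq> {}" by linarith
next
  assume R: "CARD('p) \<ge> 2 \<and> \<A> \<noteq> {}"
  then obtain a where a: "a \<in> \<A>" by blast
  define Ev where "Ev = {I \<in> inference_bases :: ('p, 'x) base set. sufficient (fst I) (\<lambda>_. undefined)} \<times> {a}"
  have "preserves Ev sufficiency_rel"
    unfolding preserves_def
  proof (intro allI impI)
    fix I1 I2 :: "('p, 'x) base"
    assume S: "(I1, I2) \<in> sufficiency_rel"
    then have "I1 \<in> inference_bases" "I2 \<in> inference_bases" unfolding sufficiency_rel_def by auto
    moreover have "sufficient (fst I1) (\<lambda>_. undefined) \<longleftrightarrow> sufficient (fst I2) (\<lambda>_. undefined)"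
      using S by (metis prod.collapse sufficiency_rel_preserves_sufficient_const)
    ultimately show "Ev `` {I1} = Ev `` {I2}" unfolding Ev_def by auto
  qed
  then have "Ev \<in> ?S" using a unfolding procedures_def Ev_def by auto
  moreover have "Ev \<notin> ?L"
  proof
    assume "Ev \<in> ?L"
    obtain E1 E2 :: "('p, 'x) model" and x1 x2 where L: "((E1, x1), (E2, x2)) \<in> likelihood_rel"
      and s: "sufficient E1 (\<lambda>_. undefined)" "\<not> sufficient E2 (\<lambda>_. undefined)"
      using likelihood_rel_not_preserves_sufficient_const[OF inf] R by metis
    have "Ev `` {(E1, x1)} = Ev `` {(E2, x2)}"
      using \<open>Ev \<in> ?L\<close> L unfolding procedures_def preserves_def by blast
    moreover have "(E1, x1) \<in> inference_bases" using L unfolding likelihood_rel_def by auto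
    ultimately show False using s unfolding Ev_def by auto
  qed
  moreover have "?L \<subseteq> ?S" by (rule procedures_antimono[OF sufficiency_rel_subset_likelihood_rel])
  ultimately show "?L \<subset> ?S" by (metis psubsetI)
qed

theorem theorem3p1:
  fixes \<A> :: "'a set"
  assumes "infinite (UNIV :: 'x set)"
  shows "procedures (likelihood_rel :: ('p::finite, 'x) base rel) \<A> = procedures conditionality_rel \<A>
    \<and> (procedures (likelihood_rel :: ('p, 'x) base rel) \<A> \<subseteq> procedures sufficiency_rel \<A>
       \<and> (procedures (likelihood_rel :: ('p, 'x) base rel) \<A> \<subset> procedures sufficiency_rel \<A>
            \<longleftrightarrow> CARD('p) \<ge> 2 \<and> \<A> \<noteq> {}))
    \<and> procedures (likelihood_rel :: ('p, 'x) base rel) \<A>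
        = procedures conditionality_rel \<A> \<inter> procedures sufficiency_rel \<A>"
proof -
  have C: "procedures (likelihood_rel :: ('p, 'x) base rel) \<A> = procedures conditionality_rel \<A>"
  proof (rule antisym)
    show "procedures (likelihood_rel :: ('p, 'x) base rel) \<A> \<subseteq> procedures conditionality_rel \<A>"
      by (rule procedures_antimono[OF conditionality_rel_subset_likelihood_rel])
    show "procedures conditionality_rel \<A> \<subseteq> procedures (likelihood_rel :: ('p, 'x) base rel) \<A>"
      by (rule subset_trans[OF procedures_relcomp_subset procedures_antimono[OF
          likelihood_rel_subset_conditionality_rel_relcomp[OF assms]]])
  qed
  have S: "procedures (likelihood_rel :: ('p, 'x) base rel) \<A> \<subseteq> procedures sufficiency_rel \<A>"
    by (rule procedures_antimono[OF sufficiency_rel_subset_likelihood_rel])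
  show ?thesis
    by (intro conjI procedures_likelihood_rel_strict_subset_iff[OF assms] C S)
      (use C S in \<open>simp add: Int_absorb2\<close>)
qed

end
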